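(* Let $t$ be a positive integer and let $A$ be a nonempty finite multiset of integers, with $\mathrm{diam}(A)=\max(A)-\min(A)$. If there exists a multiset $B$ of integers such that $A\oplus_t B=\mathbb{Z}$, then $B$ is periodic with a period $k$ satisfying \[k\le (t+1)^{\mathrm{diam}(A)}.\]
   Context: A multiset $S$ of integers is described by its weight function $w_S:\mathbb{Z}\to\mathbb{Z}_{\ge 0}$, where $w_S(n)$ is the number of occurrences of $n$ in $S$; "$n\in S$" means $w_S(n)>0$, and $\max(A)$, $\min(A)$ refer to the elements of positive weight. For a finite multiset $A$ and a multiset $B$, the representation function is $R_{A,B}(n)=\sum_{n=a+b,\ a\in A,\ b\in B} w_A(a)w_B(b)$. For a positive integer $t$, $A$ and $B$ are called $t$-complementing, written $A\oplus_t B=\mathbb{Z}$, if $A+B=\{a+b: a\in A, b\in B\}=\mathbb{Z}$ and $R_{A,B}(n)=t$ for all $n\in\mathbb{Z}$. A multiset $B$ is periodic with period $k\in\mathbb{Z}_{>0}$ if $w_B(n+k)=w_B(n)$ for all $n\in\mathbb{Z}$. *)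

theory Defs
  imports Main "HOL-Library.Multiset"
begin

text \<open>
  The type \<open>'a multiset\<close> contains only finite multisets. A possibly infinite multiset of integers
  is therefore represented by its weight function.
\<close>

type_synonym weight = "int \<Rightarrow> nat"

definition support :: "weight \<Rightarrow> int set" where
  "support w = {n. w n > 0}"

text \<open>The index set below is finite, since a pair in it is determined by \<open>a \<in> set_mset A\<close>.\<close>

definition rep_fun :: "int multiset \<Rightarrow> weight \<Rightarrow> int \<Rightarrow> nat" where
  "rep_fun A B n =
     (\<Sum>(a, b) \<in> {(a, b). a \<in># A \<and> b \<in> support B \<and> n = a + b}. count A a * B b)"

definition complementing :: "nat \<Rightarrow> int multiset \<Rightarrow> weight \<Rightarrow> bool" where
  "complementing t A B \<longleftrightarrow>
     {a + b | a b. a \<in># A \<and> b \<in> support B} = UNIV \<and> (\<forall>n. rep_fun A B n = t)"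

definition has_period :: "weight \<Rightarrow> int \<Rightarrow> bool" where
  "has_period B k \<longleftrightarrow> k > 0 \<and> (\<forall>n. B (n + k) = B n)"

text \<open>Meaningful only for \<open>A \<noteq> {#}\<close>; then the difference is nonnegative and \<^term>\<open>nat\<close> loses nothing.\<close>

definition diam :: "int multiset \<Rightarrow> nat" where
  "diam A = nat (Max (set_mset A) - Min (set_mset A))"

end

theory Submission
  imports Defs "HOL-Library.FuncSet"
begin

text \<open>
  Every value of \<open>B\<close> is at most \<open>t\<close>, so among the windows of length \<open>diam A\<close> starting at
  \<open>0, \<dots>, (t + 1) ^ diam A\<close> two coincide. The condition \<open>R n = t\<close> is a linear recurrence of order
  \<open>diam A\<close> which can be solved for its first and for its last term, so that a window determines
  \<open>B\<close> in both directions; a repeated window is therefore a period.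
\<close>

text \<open>A pair is determined by its first component, and points outside the support contribute
  0. With an index set that no longer depends on \<open>n\<close>, the condition
  \<open>R n = t\<close> becomes a linear recurrence for \<open>B\<close>.\<close>

lemma rep_fun_eq_sum: "rep_fun A B n = (\<Sum>a\<in>set_mset A. count A a * B (n - a))"
proof -
  let ?P = "{(a, b). a \<in># A \<and> b \<in> support B \<and> n = a + b}"
  let ?S = "{a \<in> set_mset A. n - a \<in> support B}"
  have "rep_fun A B n = (\<Sum>a\<in>?S. count A a * B (n - a))"
    unfolding rep_fun_def
    by (rule sum.reindex_bij_witness[where i = "\<lambda>a. (a, n - a)" and j = fst]) auto
  also have "\<dots> = (\<Sum>a\<in>set_mset A. count A a * B (n - a))"
    by (rule sum.mono_neutral_left) (auto simp: support_def)
  finally show ?thesis .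
qed

text \<open>Among the arguments \<open>n - a\<close>, the largest belongs to \<open>Min S\<close>
  and the smallest to \<open>Max S\<close>. Both coefficients are nonzero, so in a domain a window
  of zeros extends by one place on either side.\<close>

lemma recurrence_zero:
  fixes f :: "int \<Rightarrow> 'a::idom"
  assumes "finite S" "S \<noteq> {}"
    and c: "\<And>a. a \<in> S \<Longrightarrow> c a \<noteq> 0"
    and rec: "\<And>n. (\<Sum>a\<in>S. c a * f (n - a)) = 0"
    and window: "\<And>x. i \<le> x \<Longrightarrow> x < i + (Max S - Min S) \<Longrightarrow> f x = 0"
  shows "f n = 0"
proof -
  define d where "d = Max S - Min S"
  have d: "0 \<le> d"
    using assms(1,2) by (simp add: d_def)
  have ends: "Min S \<in> S" "Max S \<in> S"
    using assms(1,2) by simp_all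
  have bounds: "Min S \<le> a" "a \<le> Max S" if "a \<in> S" for a
    using that assms(1) by simp_all
  have solve: "f (n - m) = 0" if "m \<in> S" "\<And>a. a \<in> S \<Longrightarrow> a \<noteq> m \<Longrightarrow> f (n - a) = 0" for n m
  proof -
    have "(\<Sum>a\<in>S. c a * f (n - a)) = c m * f (n - m) + (\<Sum>a\<in>S - {m}. c a * f (n - a))"
      by (rule sum.remove) (use that assms(1) in auto)
    also have "(\<Sum>a\<in>S - {m}. c a * f (n - a)) = 0"
      by (rule sum.neutral) (use that in auto)
    finally show ?thesis
      using rec[of n] c[OF that(1)] by simp
  qed
  have right: "f (j + d) = 0" if "\<forall>x. j \<le> x \<and> x < j + d \<longrightarrow> f x = 0" for j
  proof -
    \<comment> \<open>The recurrence is taken at \<open>j + d + Min S\<close>: every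
      \<open>a\<close> in \<open>S\<close> other than \<open>Min S\<close> then has its argument in
      the window \<open>[j, j + d)\<close>.\<close>
    have "f (j + d + Min S - Min S) = 0"
    proof (rule solve)
      fix a assume "a \<in> S" "a \<noteq> Min S"
      then show "f (j + d + Min S - a) = 0"
        using that bounds[of a] by (simp add: d_def)
    qed (rule ends)
    then show ?thesis by simp
  qed
  have left: "f (j - 1) = 0" if "\<forall>x. j \<le> x \<and> x < j + d \<longrightarrow> f x = 0" for j
  proof -
    \<comment> \<open>The mirror image: at \<open>j - 1 + Max S\<close>, only \<open>Max S\<close>
      gives an argument outside the window.\<close>
    have "f (j - 1 + Max S - Max S) = 0"
    proof (rule solve)
      fix a assume "a \<in> S" "a \<noteq> Max S"
      then show "f (j - 1 + Max S - a) = 0"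
        using that bounds[of a] by (simp add: d_def)
    qed (rule ends)
    then show ?thesis by simp
  qed
  have all: "\<forall>x. j \<le> x \<and> x < j + d \<longrightarrow> f x = 0" for j
  proof (induction j rule: int_induct[where k = i])
    case base
    then show ?case using window by (simp add: d_def)
  next
    case (step1 j)
    show ?case
    proof (intro allI impI)
      fix x assume "j + 1 \<le> x \<and> x < j + 1 + d"
      then show "f x = 0"
        using step1(2) right[OF step1(2)] by (cases "x = j + d") auto
    qed
  next
    case (step2 j)
    show ?case
    proof (intro allI impI)
      fix x assume "j - 1 \<le> x \<and> x < j - 1 + d"
      then show "f x = 0"
        using step2(2) left[OF step2(2)] by (cases "x = j - 1") auto
    qed
  qed
  \<comment> \<open>Using the point just after a window, rather than one inside it, also covers
    \<open>d = 0\<close>, where windows are empty.\<close>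
  show ?thesis
    using right[OF all[of "n - d"]] by simp
qed

text \<open>Pigeonhole: there are \<open>(t + 1) ^ d\<close> possible windows but one more starting
  point in \<open>{0..(t + 1) ^ d}\<close>, and two such points differ by at most
  \<open>(t + 1) ^ d\<close>.\<close>

lemma repeated_window:
  fixes B :: "int \<Rightarrow> nat"
  assumes "\<And>n. B n \<le> t"
  obtains i j :: int
  where "i < j" "j - i \<le> (int t + 1) ^ d"
    and "\<And>x. i \<le> x \<Longrightarrow> x < i + int d \<Longrightarrow> B (x + (j - i)) = B x"
proof -
  note found = that
  define N where "N = (t + 1) ^ d"
  \<comment> \<open>Restriction makes each window an extensional function, so that windows lie in a
    finite set of known cardinality and their equality means agreement at all \<open>d\<close>
    places.\<close>
  define win where "win = (\<lambda>p::nat. restrict (\<lambda>q. B (int p + int q)) {..<d})"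
  let ?W = "{..<d} \<rightarrow>\<^sub>E {..t}"
  have W: "finite ?W" "card ?W = N"
    by (simp_all add: finite_PiE card_PiE N_def)
  have "win ` {..N} \<subseteq> ?W"
    using assms by (auto simp: win_def split: if_splits)
  then have "card (win ` {..N}) \<le> N"
    using card_mono W by metis
  then have "\<not> inj_on win {..N}"
    by (intro pigeonhole) simp
  then obtain p q where pq: "p \<le> N" "q \<le> N" "p \<noteq> q" "win p = win q"
    unfolding inj_on_def by auto
  have *: thesis if "p < q" "q \<le> N" "win p = win q" for p q
  proof (rule found[of "int p" "int q"])
    have "int q - int p \<le> int N"
      using \<open>q \<le> N\<close> by linarith
    then show "int q - int p \<le> (int t + 1) ^ d"
      by (simp add: N_def add.commute)
    fix x assume "int p \<le> x" "x < int p + int d"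
    then obtain r where r: "x = int p + int r" "r < d"
      by (metis add_less_cancel_left of_nat_less_iff zle_iff_zadd)
    have "win p r = win q r"
      using \<open>win p = win q\<close> by simp
    with r show "B (x + (int q - int p)) = B x"
      by (simp add: win_def algebra_simps)
  qed (use \<open>p < q\<close> in simp)
  show thesis
    using *[of p q] *[of q p] pq by (cases "p < q") auto
qed

theorem theorem4:
  fixes t :: nat and A :: "int multiset" and B :: weight
  assumes "t > 0"
    and "A \<noteq> {#}"
    and "complementing t A B"
  shows "\<exists>k. has_period B k \<and> k \<le> (int t + 1) ^ diam A"
proof -
  have R: "(\<Sum>a\<in>set_mset A. count A a * B (n - a)) = t" for n
    using assms(3) by (simp add: complementing_def rep_fun_eq_sum)
  have "B n \<le> t" for n
  proof -
    obtain a where a: "a \<in># A"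
      using assms(2) by blast
    \<comment> \<open>The multiplicity of \<open>a\<close> is at least 1, and the right-hand side is
      a single term of the sum for \<open>n + a\<close>, whose total is \<open>t\<close>.\<close>
    have "B n \<le> count A a * B (n + a - a)"
      using a by (simp add: Suc_le_eq)
    also have "\<dots> \<le> (\<Sum>a'\<in>set_mset A. count A a' * B (n + a - a'))"
      by (rule member_le_sum) (use a in auto)
    finally show ?thesis
      using R by simp
  qed
  then obtain i j where ij: "i < j" "j - i \<le> (int t + 1) ^ diam A"
    and window: "\<And>x. i \<le> x \<Longrightarrow> x < i + int (diam A) \<Longrightarrow> B (x + (j - i)) = B x"
    using repeated_window[of B t "diam A"] by blast
  define k where "k = j - i"
  have d: "int (diam A) = Max (set_mset A) - Min (set_mset A)"
    using assms(2) by (simp add: diam_def)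
  \<comment> \<open>Subtracting the recurrences at \<open>n + k\<close> and \<open>n\<close> cancels
    the constant \<open>t\<close>, so the difference satisfies the homogeneous recurrence. It is
    formed in the integers because subtraction of naturals truncates.\<close>
  have "int (B (n + k)) - int (B n) = 0" for n
  proof (rule recurrence_zero[where S = "set_mset A" and c = "\<lambda>a. int (count A a)" and i = i
        and f = "\<lambda>n. int (B (n + k)) - int (B n)"])
    fix n
    have "(\<Sum>a\<in>set_mset A. int (count A a) * (int (B (n - a + k)) - int (B (n - a))))
      = int (\<Sum>a\<in>set_mset A. count A a * B (n + k - a)) - int (\<Sum>a\<in>set_mset A. count A a * B (n - a))"
      by (simp add: sum_subtractf[symmetric] algebra_simps)
    then show "(\<Sum>a\<in>set_mset A. int (count A a) * (int (B (n - a + k)) - int (B (n - a)))) = 0"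
      by (simp only: R)
  next
    fix x assume "i \<le> x" "x < i + (Max (set_mset A) - Min (set_mset A))"
    then show "int (B (x + k)) - int (B x) = 0"
      using window[of x] by (simp add: d k_def)
  qed (use assms(2) in auto)
  then have "has_period B k"
    using ij(1) by (simp add: has_period_def k_def)
  then show ?thesis
    using ij(2) by (auto simp: k_def)
qed

end
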